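(* Consider the system of ordinary differential equations $$\begin{aligned} \frac{dx}{dt} &=\frac{2x^2y}{t}+x^2-\frac{2xy}{t}-\left(1+\frac{2\alpha_2+2\alpha_3+\alpha_5+\alpha_4}{t}\right)x+\frac{\alpha_2+\alpha_5}{t}+\frac{2z((z-1)w+\alpha_3)}{t},\\ \frac{dy}{dt} &=-\frac{2xy^2}{t}+\frac{y^2}{t}-2xy+\left(1+\frac{2\alpha_2+2\alpha_3+\alpha_5+\alpha_4}{t}\right)y-\alpha_1,\\ \frac{dz}{dt} &=\frac{2z^2w}{t}+z^2-\frac{2zw}{t}-\left(1+\frac{\alpha_5+\alpha_4}{t}\right)z+\frac{\alpha_5}{t}+\frac{2yz(z-1)}{t},\\ \frac{dw}{dt} &=-\frac{2zw^2}{t}+\frac{w^2}{t}-2zw+\left(1+\frac{\alpha_5+\alpha_4}{t}\right)w-\alpha_3-\frac{2y(-w+2zw+\alpha_3)}{t}, \end{aligned}$$ where $\alpha_0,\dots,\alpha_5$ are complex parameters with $\alpha_0+\alpha_1+2\alpha_2+2\alpha_3+\alpha_4+\alpha_5=1$. This system admits extended affine Weyl group symmetry of type $D_5^{(1)}$ as the group of its Bäcklund transformations, with generators $s_0,\dots,s_5,\pi_1,\dots,\pi_4$ defined as follows, with the notation $( * ):=(x,y,z,w,t;\alpha_0,\alpha_1,\dots,\alpha_5)$: $$\begin{aligned} s_0: ( * ) &\to \left(x+\tfrac{\alpha_0}{y+t},y,z,w,t;-\alpha_0,\alpha_1,\alpha_2+\alpha_0,\alpha_3,\alpha_4,\alpha_5\right),\\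 s_1: ( * ) &\to \left(x+\tfrac{\alpha_1}{y},y,z,w,t;\alpha_0,-\alpha_1,\alpha_2+\alpha_1,\alpha_3,\alpha_4,\alpha_5\right),\\ s_2: ( * ) &\to \left(x,y-\tfrac{\alpha_2}{x-z},z,w+\tfrac{\alpha_2}{x-z},t;\alpha_0+\alpha_2,\alpha_1+\alpha_2,-\alpha_2,\alpha_3+\alpha_2,\alpha_4,\alpha_5\right),\\ s_3: ( * ) &\to \left(x,y,z+\tfrac{\alpha_3}{w},w,t;\alpha_0,\alpha_1,\alpha_2+\alpha_3,-\alpha_3,\alpha_4+\alpha_3,\alpha_5+\alpha_3\right),\\ s_4: ( * ) &\to \left(x,y,z,w-\tfrac{\alpha_4}{z-1},t;\alpha_0,\alpha_1,\alpha_2,\alpha_3+\alpha_4,-\alpha_4,\alpha_5\right),\\ s_5: ( * ) &\to \left(x,y,z,w-\tfrac{\alpha_5}{z},t;\alpha_0,\alpha_1,\alpha_2,\alpha_3+\alpha_5,\alpha_4,-\alpha_5\right),\\ \pi_1: ( * ) &\to (1-x,-y-t,1-z,-w,t;\alpha_1,\alpha_0,\alpha_2,\alpha_3,\alpha_5,\alpha_4),\\ \pi_2: ( * ) &\to \left(\tfrac{y+w+t}{t},-t(z-1),\tfrac{y+t}{t},-t(x-z),-t;\alpha_5,\alpha_4,\alpha_3,\alpha_2,\alpha_1,\alpha_0\right),\\ \pi_3: ( * ) &\to (1-x,-y,1-z,-w,-t;\alpha_0,\alpha_1,\alpha_2,\alpha_3,\alpha_5,\alpha_4),\\ \pi_4: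 ( * ) &\to (x,y+t,z,w,-t;\alpha_1,\alpha_0,\alpha_2,\alpha_3,\alpha_4,\alpha_5). \end{aligned}$$ That is, each of these transformations is a Bäcklund transformation of the system, and they satisfy $s_i^2=1$ $(0\le i\le 5)$, $\pi_j^2=1$ $(1\le j\le 4)$, $(s_0s_1)^2=(s_0s_3)^2=(s_0s_4)^2=(s_0s_5)^2=(s_1s_3)^2=(s_1s_4)^2=(s_1s_5)^2=(s_2s_4)^2=(s_2s_5)^2=(s_4s_5)^2=1$ and $(s_0s_2)^3=(s_1s_2)^3=(s_2s_3)^3=(s_3s_4)^3=(s_3s_5)^3=1$.
   Context: A Bäcklund transformation of the system is a birational transformation $(x,y,z,w,t;\alpha)\to(\tilde x,\tilde y,\tilde z,\tilde w,\tilde t;\tilde\alpha)$ such that whenever $(x,y,z,w)$ solves the system with independent variable $t$ and parameters $\alpha$, the functions $(\tilde x,\tilde y,\tilde z,\tilde w)$ solve the same system with independent variable $\tilde t$ and parameters $\tilde\alpha$. The relations are understood as relations between birational transformations of the variables $(x,y,z,w,t;\alpha_0,\dots,\alpha_5)$ subject to $\alpha_0+\alpha_1+2\alpha_2+2\alpha_3+\alpha_4+\alpha_5=1$. The listed relations among $s_0,\dots,s_5$ are the Coxeter relations of the affine Weyl group $W(D_5^{(1)})$ whose Dynkin diagram has edges $0-2$, $1-2$, $2-3$, $3-4$, $3-5$; "extended" refers to the additional generators $\pi_j$. *)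

theory Defs
  imports "HOL-Analysis.Analysis"
begin

section \<open>The space of variables\<close>

text \<open>
  A point is \<open>(x, y, z, w, t; \<alpha>\<^sub>0, \<dots>, \<alpha>\<^sub>5)\<close>. As tuples associate to the right,
  \<open>(x, y, z, w, t, \<alpha>)\<close> with \<open>\<alpha> :: params\<close> is a point as well.
\<close>

type_synonym params = "complex \<times> complex \<times> complex \<times> complex \<times> complex \<times> complex"
type_synonym point = "complex \<times> complex \<times> complex \<times> complex \<times> complex \<times> params"

definition parameter_space :: "params set" where
  "parameter_space = {(a0, a1, a2, a3, a4, a5). a0 + a1 + 2 * a2 + 2 * a3 + a4 + a5 = 1}"

definition total_space :: "point set" where
  "total_space = {(x, y, z, w, t, \<alpha>). \<alpha> \<in> parameter_space}"

fun coord :: "nat \<Rightarrow> point \<Rightarrow> complex" where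
  "coord i (x, y, z, w, t, a0, a1, a2, a3, a4, a5) = [x, y, z, w, t, a0, a1, a2, a3, a4, a5] ! i"


section \<open>Birational transformations\<close>

inductive polynomial_fun :: "(point \<Rightarrow> complex) \<Rightarrow> bool" where
  const: "polynomial_fun (\<lambda>_. c)"
| coord: "i < 11 \<Longrightarrow> polynomial_fun (coord i)"
| add: "polynomial_fun f \<Longrightarrow> polynomial_fun g \<Longrightarrow> polynomial_fun (\<lambda>p. f p + g p)"
| mult: "polynomial_fun f \<Longrightarrow> polynomial_fun g \<Longrightarrow> polynomial_fun (\<lambda>p. f p * g p)"

text \<open>
  \<open>P\<close> holds on a nonempty Zariski open subset of \<open>total_space\<close>. The latter is an affine
  hyperplane, hence irreducible, so that such subsets are dense.
\<close>

definition generically :: "(point \<Rightarrow> bool) \<Rightarrow> bool" where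
  "generically P \<longleftrightarrow>
     (\<exists>g. polynomial_fun g \<and> (\<exists>p\<in>total_space. g p \<noteq> 0) \<and>
          (\<forall>p\<in>total_space. g p \<noteq> 0 \<longrightarrow> P p))"

text \<open>
  Rational self-maps of \<open>total_space\<close> are represented by partial functions: the domain is a
  nonempty Zariski open set, and near each point of it the coordinates of the value are
  quotients of polynomials, written with a common denominator \<open>d\<close>. Two representatives give
  the same rational map if they are defined and agree generically. As the domain of a
  composition \<open>F \<circ>\<^sub>m G\<close> may in general be empty, \<open>rat_eq\<close> demands definedness explicitly.
\<close>

definition rational_map :: "(point \<Rightarrow> point option) \<Rightarrow> bool" where
  "rational_map F \<longleftrightarrow>
     (\<exists>p\<in>total_space. F p \<noteq> None) \<and>
     (\<forall>p\<in>total_space. F p \<noteq> None \<longrightarrow>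
        (\<exists>N d. (\<forall>i<11. polynomial_fun (N i)) \<and> polynomial_fun d \<and> d p \<noteq> 0 \<and>
               (\<forall>q\<in>total_space. d q \<noteq> 0 \<longrightarrow>
                  (\<exists>r\<in>total_space. F q = Some r \<and> (\<forall>i<11. coord i r = N i q / d q)))))"

definition rat_eq :: "(point \<Rightarrow> point option) \<Rightarrow> (point \<Rightarrow> point option) \<Rightarrow> bool"
    (infix \<open>\<approx>\<close> 50) where
  "F \<approx> G \<longleftrightarrow> generically (\<lambda>p. F p \<noteq> None \<and> F p = G p)"

abbreviation rat_id :: "point \<Rightarrow> point option" where
  "rat_id \<equiv> Some"

primrec rat_power :: "(point \<Rightarrow> point option) \<Rightarrow> nat \<Rightarrow> (point \<Rightarrow> point option)" where
  "rat_power F 0 = rat_id"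
| "rat_power F (Suc n) = F \<circ>\<^sub>m rat_power F n"

definition birational :: "(point \<Rightarrow> point option) \<Rightarrow> bool" where
  "birational F \<longleftrightarrow> rational_map F \<and>
     (\<exists>G. rational_map G \<and> F \<circ>\<^sub>m G \<approx> rat_id \<and> G \<circ>\<^sub>m F \<approx> rat_id)"


section \<open>The system\<close>

fun rhs_x :: "point \<Rightarrow> complex" where
  "rhs_x (x, y, z, w, t, a0, a1, a2, a3, a4, a5) =
     2 * x^2 * y / t + x^2 - 2 * x * y / t - (1 + (2 * a2 + 2 * a3 + a5 + a4) / t) * x
     + (a2 + a5) / t + 2 * z * ((z - 1) * w + a3) / t"

fun rhs_y :: "point \<Rightarrow> complex" where
  "rhs_y (x, y, z, w, t, a0, a1, a2, a3, a4, a5) =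
     - (2 * x * y^2 / t) + y^2 / t - 2 * x * y + (1 + (2 * a2 + 2 * a3 + a5 + a4) / t) * y - a1"

fun rhs_z :: "point \<Rightarrow> complex" where
  "rhs_z (x, y, z, w, t, a0, a1, a2, a3, a4, a5) =
     2 * z^2 * w / t + z^2 - 2 * z * w / t - (1 + (a5 + a4) / t) * z
     + a5 / t + 2 * y * z * (z - 1) / t"

fun rhs_w :: "point \<Rightarrow> complex" where
  "rhs_w (x, y, z, w, t, a0, a1, a2, a3, a4, a5) =
     - (2 * z * w^2 / t) + w^2 / t - 2 * z * w + (1 + (a5 + a4) / t) * w - a3
     - 2 * y * (- w + 2 * z * w + a3) / t"

text \<open>Solutions are holomorphic functions on an open set avoiding the singularity \<open>t = 0\<close>.\<close>

definition solution ::
    "complex set \<Rightarrow> (complex \<Rightarrow> complex) \<Rightarrow> (complex \<Rightarrow> complex) \<Rightarrow> (complex \<Rightarrow> complex) \<Rightarrow>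
     (complex \<Rightarrow> complex) \<Rightarrow> params \<Rightarrow> bool" where
  "solution D x y z w \<alpha> \<longleftrightarrow> open D \<and> 0 \<notin> D \<and> \<alpha> \<in> parameter_space \<and>
     (\<forall>t\<in>D. (x has_field_derivative rhs_x (x t, y t, z t, w t, t, \<alpha>)) (at t) \<and>
             (y has_field_derivative rhs_y (x t, y t, z t, w t, t, \<alpha>)) (at t) \<and>
             (z has_field_derivative rhs_z (x t, y t, z t, w t, t, \<alpha>)) (at t) \<and>
             (w has_field_derivative rhs_w (x t, y t, z t, w t, t, \<alpha>)) (at t))"

text \<open>
  In the transformed solution the new independent variable is \<open>\<tau> t\<close>, with \<open>t\<close> ranging over
  \<open>D\<close>, and the new dependent variables are functions of it. The new parameters \<open>\<alpha>'\<close> do not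
  depend on \<open>t\<close>. Solutions on which \<open>T\<close> has poles are covered by shrinking \<open>D\<close>; only those
  lying entirely in the locus where \<open>T\<close> is undefined are not transformed.
\<close>

definition baecklund_transformation :: "(point \<Rightarrow> point option) \<Rightarrow> bool" where
  "baecklund_transformation T \<longleftrightarrow> birational T \<and>
     (\<forall>D x y z w \<alpha>.
        solution D x y z w \<alpha> \<and> (\<forall>t\<in>D. T (x t, y t, z t, w t, t, \<alpha>) \<noteq> None) \<longrightarrow>
        (\<exists>\<tau> x' y' z' w' \<alpha>'. solution (\<tau> ` D) x' y' z' w' \<alpha>' \<and>
           (\<forall>t\<in>D. T (x t, y t, z t, w t, t, \<alpha>) =
                    Some (x' (\<tau> t), y' (\<tau> t), z' (\<tau> t), w' (\<tau> t), \<tau> t, \<alpha>'))))"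


section \<open>The generators\<close>

fun s0 :: "point \<Rightarrow> point option" where
  "s0 (x, y, z, w, t, a0, a1, a2, a3, a4, a5) =
     (if y + t = 0 then None
      else Some (x + a0 / (y + t), y, z, w, t, - a0, a1, a2 + a0, a3, a4, a5))"

fun s1 :: "point \<Rightarrow> point option" where
  "s1 (x, y, z, w, t, a0, a1, a2, a3, a4, a5) =
     (if y = 0 then None
      else Some (x + a1 / y, y, z, w, t, a0, - a1, a2 + a1, a3, a4, a5))"

fun s2 :: "point \<Rightarrow> point option" where
  "s2 (x, y, z, w, t, a0, a1, a2, a3, a4, a5) =
     (if x - z = 0 then None
      else Some (x, y - a2 / (x - z), z, w + a2 / (x - z), t,
                 a0 + a2, a1 + a2, - a2, a3 + a2, a4, a5))"

fun s3 :: "point \<Rightarrow> point option" where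
  "s3 (x, y, z, w, t, a0, a1, a2, a3, a4, a5) =
     (if w = 0 then None
      else Some (x, y, z + a3 / w, w, t, a0, a1, a2 + a3, - a3, a4 + a3, a5 + a3))"

fun s4 :: "point \<Rightarrow> point option" where
  "s4 (x, y, z, w, t, a0, a1, a2, a3, a4, a5) =
     (if z - 1 = 0 then None
      else Some (x, y, z, w - a4 / (z - 1), t, a0, a1, a2, a3 + a4, - a4, a5))"

fun s5 :: "point \<Rightarrow> point option" where
  "s5 (x, y, z, w, t, a0, a1, a2, a3, a4, a5) =
     (if z = 0 then None
      else Some (x, y, z, w - a5 / z, t, a0, a1, a2, a3 + a5, a4, - a5))"

fun pi1 :: "point \<Rightarrow> point option" where
  "pi1 (x, y, z, w, t, a0, a1, a2, a3, a4, a5) =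
     Some (1 - x, - y - t, 1 - z, - w, t, a1, a0, a2, a3, a5, a4)"

fun pi2 :: "point \<Rightarrow> point option" where
  "pi2 (x, y, z, w, t, a0, a1, a2, a3, a4, a5) =
     (if t = 0 then None
      else Some ((y + w + t) / t, - t * (z - 1), (y + t) / t, - t * (x - z), - t,
                 a5, a4, a3, a2, a1, a0))"

fun pi3 :: "point \<Rightarrow> point option" where
  "pi3 (x, y, z, w, t, a0, a1, a2, a3, a4, a5) =
     Some (1 - x, - y, 1 - z, - w, - t, a0, a1, a2, a3, a5, a4)"

fun pi4 :: "point \<Rightarrow> point option" where
  "pi4 (x, y, z, w, t, a0, a1, a2, a3, a4, a5) =
     Some (x, y + t, z, w, - t, a1, a0, a2, a3, a4, a5)"

end

theory Submission
  imports Defs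
begin

text \<open>
  Each of the maps \<open>s\<^sub>0, \<dots>, s\<^sub>5\<close> displaces a point by \<open>\<alpha>\<^sub>i / f\<^sub>i\<close> times a fixed vector \<open>e\<^sub>i\<close>,
  where \<open>f\<^sub>i\<close> is a polynomial of degree one in the variables, and acts on the parameters as a
  simple reflection. The vector \<open>e\<^sub>i\<close> is the Hamiltonian vector field of \<open>f\<^sub>i\<close>, and the derivative
  of \<open>f\<^sub>j\<close> in the direction \<open>e\<^sub>i\<close> is \<open>0\<close> if \<open>i = j\<close> or the nodes \<open>i\<close> and \<open>j\<close> are not joined in the
  Dynkin diagram, and \<open>1\<close> or \<open>-1\<close> otherwise. The Coxeter relations follow from these numbers and
  the Cartan matrix alone: \<open>s\<^sub>i\<close> preserves \<open>f\<^sub>i\<close> and negates \<open>\<alpha>\<^sub>i\<close>, hence is an involution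
  (\<open>simple_reflection_square\<close>); reflections at nodes that are not joined do not affect each other's
  data (\<open>commutation_relation\<close>); and for joined nodes the orbit of a generic point under the
  alternating word can be written down in closed form, and returns to its start after six steps
  (\<open>braid_relation\<close>). Each relation holds wherever an explicit polynomial is nonzero, which gives
  equality of rational maps (\<open>rat_eq_idI\<close>).

  All ten generators are involutions, hence birational as soon as they are rational.

  The Baecklund property reduces by the chain rule to identities between rational functions, which
  say that the map carries the vector field of the system to the one with the new parameters
  (\<open>baecklund_transformationI\<close>). They are verified by clearing denominators
  (\<open>rhs_s0\<close>, \<open>\<dots>\<close>, \<open>rhs_pi4\<close>).
\<close>

section \<open>Rational maps and generic equality\<close>

lemma polynomial_fun_uminus:
  assumes "polynomial_fun f" shows "polynomial_fun (\<lambda>p. - f p)"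
  using polynomial_fun.mult[OF polynomial_fun.const[of "-1"] assms] by simp

lemma polynomial_fun_diff:
  assumes "polynomial_fun f" "polynomial_fun g" shows "polynomial_fun (\<lambda>p. f p - g p)"
  using polynomial_fun.add[OF assms(1) polynomial_fun_uminus[OF assms(2)]] by simp

lemmas polynomial_intros = polynomial_fun.intros polynomial_fun_uminus polynomial_fun_diff

lemma point_cases:
  obtains x y z w t a0 a1 a2 a3 a4 a5 where "(p :: point) = (x, y, z, w, t, a0, a1, a2, a3, a4, a5)"
proof -
  obtain x y z w t \<alpha> where "p = (x, y, z, w, t, \<alpha>)" by (cases p)
  moreover obtain a0 a1 a2 a3 a4 a5 where "\<alpha> = (a0, a1, a2, a3, a4, a5)" by (cases \<alpha>)
  ultimately show ?thesis using that by blast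
qed

text \<open>
  All maps below have one global expression with a common denominator that vanishes exactly
  where the map is undefined, so the same list of numerators serves every point of the domain.
\<close>
lemma rational_mapI:
  assumes len: "length Ns = 11" and Ns: "\<And>N. N \<in> set Ns \<Longrightarrow> polynomial_fun N" and d: "polynomial_fun d"
    and p: "p \<in> total_space" "d p \<noteq> 0"
    and None: "\<And>q. q \<in> total_space \<Longrightarrow> d q = 0 \<Longrightarrow> F q = None"
    and Some: "\<And>q. q \<in> total_space \<Longrightarrow> d q \<noteq> 0 \<Longrightarrow>
      \<exists>r\<in>total_space. F q = Some r \<and> (\<forall>i<11. coord i r = (Ns ! i) q / d q)"
  shows "rational_map F"
  unfolding rational_map_def
proof (intro conjI ballI impI)
  show "\<exists>p\<in>total_space. F p \<noteq> None"
  proof (rule bexI[OF _ p(1)])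
    show "F p \<noteq> None" using Some[OF p] by (metis option.distinct(1))
  qed
next
  fix q assume q: "q \<in> total_space" "F q \<noteq> None"
  then have "d q \<noteq> 0" using None[OF q(1)] by metis
  moreover have "\<forall>i<11. polynomial_fun (Ns ! i)"
    using Ns len by simp
  ultimately show "\<exists>N d. (\<forall>i<11. polynomial_fun (N i)) \<and> polynomial_fun d \<and> d q \<noteq> 0 \<and>
     (\<forall>q\<in>total_space. d q \<noteq> 0 \<longrightarrow>
        (\<exists>r\<in>total_space. F q = Some r \<and> (\<forall>i<11. coord i r = N i q / d q)))"
    using d Some by blast
qed

text \<open>
  One point at which every polynomial that has to be nonzero somewhere is nonzero: all
  denominators of the generators take the values 1 or 2 here, and all parameters but
  \<open>\<alpha>\<^sub>0 = 1\<close> vanish, which keeps the mixed factors in the braid relations nonzero as well.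
\<close>
definition base_point :: point where
  "base_point = (3, 1, 2, 1, 1, 1, 0, 0, 0, 0, 0)"

lemma base_point_in_total_space: "base_point \<in> total_space"
  by (simp add: base_point_def total_space_def parameter_space_def)

text \<open>
  Compositions are shown to be the identity wherever a suitable polynomial is nonzero; for
  a statement about rational maps this suffices, because a single point with a nonzero value
  shows that the exceptional set is a proper Zariski closed one.
\<close>
lemma rat_eq_idI:
  assumes "polynomial_fun g" "g base_point \<noteq> 0" "\<And>p. g p \<noteq> 0 \<Longrightarrow> F p = Some p"
  shows "F \<approx> rat_id"
  unfolding rat_eq_def generically_def
proof (intro exI[of _ g] conjI ballI impI)
  show "\<exists>p\<in>total_space. g p \<noteq> 0" using assms(2) base_point_in_total_space by blast
qed (simp_all only: assms option.distinct not_False_eq_True)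

lemma birational_involution:
  assumes "rational_map F" and "rat_power F 2 \<approx> rat_id"
  shows "birational F"
proof -
  have "rat_power F 2 = F \<circ>\<^sub>m F"
    by (simp add: numeral_2_eq_2 map_comp_def)
  with assms show ?thesis
    unfolding birational_def by (metis (no_types))
qed

section \<open>The simple reflections as shifts along fixed directions\<close>

text \<open>
  The polynomial \<open>wall i\<close> is the denominator of \<open>s\<^sub>i\<close>.
\<close>
definition wall :: "nat \<Rightarrow> point \<Rightarrow> complex" where
  "wall i p = [coord 1 p + coord 4 p, coord 1 p, coord 0 p - coord 2 p, coord 3 p, coord 2 p - 1, coord 2 p] ! i"

text \<open>The parameters \<open>\<alpha>\<^sub>i\<close> play the role of the simple roots.\<close>
abbreviation root :: "nat \<Rightarrow> point \<Rightarrow> complex" where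
  "root i \<equiv> coord (5 + i)"

text \<open>
  The directions in which the reflections move a point: \<open>u i\<close> is the distance travelled in the
  direction of \<open>s\<^sub>i\<close> (in Hamiltonian terms, along the Hamiltonian vector field of \<open>wall i\<close>), and
  \<open>m i\<close> is the multiple of row \<open>i\<close> of the Cartan matrix of affine type \<open>D\<^sub>5\<close> subtracted from
  the parameters. Both actions are additive in \<open>u\<close> and \<open>m\<close>, so the orbit of a point under any
  word in the reflections can be recorded by the pairs \<open>(u, m)\<close> alone.
\<close>
fun move :: "point \<Rightarrow> (nat \<Rightarrow> complex) \<Rightarrow> (nat \<Rightarrow> complex) \<Rightarrow> point" where
  "move (x, y, z, w, t, a0, a1, a2, a3, a4, a5) u m =
     (x + u 0 + u 1, y - u 2, z + u 3, w + u 2 - u 4 - u 5, t,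
      a0 - 2 * m 0 + m 2, a1 - 2 * m 1 + m 2, a2 + m 0 + m 1 - 2 * m 2 + m 3,
      a3 + m 2 - 2 * m 3 + m 4 + m 5, a4 + m 3 - 2 * m 4, a5 + m 3 - 2 * m 5)"

text \<open>
  The action is described at moved points \<open>move p u m\<close> rather than at \<open>p\<close>, so that it can be iterated
  with the starting point \<open>p\<close> kept fixed.
\<close>
definition simple_reflection :: "nat \<Rightarrow> (point \<Rightarrow> point option) \<Rightarrow> bool" where
  "simple_reflection i S \<longleftrightarrow> i < 6 \<and> (\<forall>p u m. S (move p u m) =
     (let q = move p u m; a = root i q; f = wall i q in
      if f = 0 then None else Some (move p (u(i := u i + a / f)) (m(i := m i + a)))))"

lemma simple_reflections:
  "simple_reflection 0 s0" "simple_reflection 1 s1" "simple_reflection 2 s2"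
  "simple_reflection 3 s3" "simple_reflection 4 s4" "simple_reflection 5 s5"
  unfolding simple_reflection_def split_paired_all split_paired_All
  by (simp_all add: wall_def Let_def)

lemma move_0: "move p (\<lambda>_. 0) (\<lambda>_. 0) = p"
  by (cases p rule: point_cases) simp

lemma less_6E:
  assumes "i < (6::nat)"
  obtains "i = 0" | "i = 1" | "i = 2" | "i = 3" | "i = 4" | "i = 5"
  using assms by linarith

lemma polynomial_fun_wall: "i < 6 \<Longrightarrow> polynomial_fun (wall i)"
  unfolding wall_def[abs_def]
  by (elim less_6E) (auto simp: numeral_2_eq_2 intro!: polynomial_intros)

lemma simple_reflectionD:
  assumes "simple_reflection i S" "wall i (move p u m) \<noteq> 0"
  shows "S (move p u m) = Some (move p
    (u(i := u i + root i (move p u m) / wall i (move p u m))) (m(i := m i + root i (move p u m))))"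
  using assms unfolding simple_reflection_def Let_def by presburger

lemma simple_reflection_eq:
  assumes "simple_reflection i S"
  shows "S p = (if wall i p = 0 then None
    else Some (move p ((\<lambda>_. 0)(i := root i p / wall i p)) ((\<lambda>_. 0)(i := root i p))))"
proof -
  have "S (move p (\<lambda>_. 0) (\<lambda>_. 0)) = (let q = move p (\<lambda>_. 0) (\<lambda>_. 0); a = root i q; f = wall i q in
      if f = 0 then None else Some (move p ((\<lambda>_. 0)(i := 0 + a / f)) ((\<lambda>_. 0)(i := 0 + a))))"
    using assms unfolding simple_reflection_def by blast
  then show ?thesis by (simp add: move_0 Let_def)
qed

lemma wall_root_move_self:
  assumes "i < 6"
  shows "wall i (move p ((\<lambda>_. 0)(i := u)) ((\<lambda>_. 0)(i := m))) = wall i p"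
    and "root i (move p ((\<lambda>_. 0)(i := u)) ((\<lambda>_. 0)(i := m))) = root i p - 2 * m"
  using assms by (atomize (full), cases p rule: point_cases) (auto elim!: less_6E simp: wall_def)

text \<open>
  A reflection does not change its own denominator and negates its own root, so the second
  application adds \<open>- \<alpha>\<^sub>i / f\<^sub>i\<close> where the first has added \<open>\<alpha>\<^sub>i / f\<^sub>i\<close>.
\<close>
lemma simple_reflection_square:
  assumes S: "simple_reflection i S"
  shows "rat_power S 2 \<approx> rat_id"
proof (rule rat_eq_idI[of "wall i"])
  have i: "i < 6" using S by (simp add: simple_reflection_def)
  then show "polynomial_fun (wall i)" by (rule polynomial_fun_wall)
  show "wall i base_point \<noteq> 0"
    using i by (auto elim!: less_6E simp: wall_def base_point_def)
  fix p assume f: "wall i p \<noteq> 0"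
  have "S (move p ((\<lambda>_. 0)(i := root i p / wall i p)) ((\<lambda>_. 0)(i := root i p))) = Some p"
    using f simple_reflectionD[OF S, of p "(\<lambda>_. 0)(i := root i p / wall i p)" "(\<lambda>_. 0)(i := root i p)"]
    by (simp add: wall_root_move_self[OF i] diff_divide_distrib fun_upd_idem move_0)
  then show "rat_power S 2 p = Some p"
    using f by (simp add: numeral_2_eq_2 simple_reflection_eq[OF S])
qed

lemma move_total_space: "p \<in> total_space \<Longrightarrow> move p u m \<in> total_space"
  by (cases p rule: point_cases) (auto simp: total_space_def parameter_space_def algebra_simps)

lemma less_11E:
  assumes "i < (11::nat)"
  obtains "i = 0" | "i = 1" | "i = 2" | "i = 3" | "i = 4" | "i = 5" | "i = 6" | "i = 7" | "i = 8" | "i = 9" | "i = 10"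
  using assms by atomize_elim presburger

text \<open>
  For a single index each coordinate moves by a constant multiple of \<open>a\<close> (variables) or \<open>b\<close>
  (parameters); the constant is read off by moving the origin with \<open>a = b = 1\<close>.
\<close>
lemma coord_move_single:
  assumes "i < 6" "k < 11"
  shows "\<exists>c. \<forall>p a b. coord k (move p ((\<lambda>_. 0)(i := a)) ((\<lambda>_. 0)(i := b))) = coord k p + c * (if k < 5 then a else b)"
  using assms
  by (intro exI[of _ "coord k (move 0 ((\<lambda>_. 0)(i := 1)) ((\<lambda>_. 0)(i := 1)))"])
    (elim less_6E; elim less_11E; simp add: split_paired_all split_paired_All zero_prod_def)

lemma rational_simple_reflection:
  assumes S: "simple_reflection i S"
  shows "rational_map S"
proof -
  have i: "i < 6" using S by (simp add: simple_reflection_def)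
  obtain c where c: "\<And>k p a b. k < 11 \<Longrightarrow>
    coord k (move p ((\<lambda>_. 0)(i := a)) ((\<lambda>_. 0)(i := b))) = coord k p + c k * (if k < 5 then a else b)"
    using coord_move_single[OF i] by metis
  define N where "N k = (\<lambda>p. coord k p * wall i p + c k * root i p * (if k < 5 then 1 else wall i p))" for k
  show ?thesis
  proof (rule rational_mapI[of "map N [0..<11]" "wall i" base_point])
    show "polynomial_fun F" if "F \<in> set (map N [0..<11])" for F
    proof -
      obtain k where k: "k < 11" "F = N k" using \<open>F \<in> _\<close> by auto
      show ?thesis
        unfolding k(2) N_def
        by (cases "k < 5") (use i k in \<open>auto intro!: polynomial_intros polynomial_fun_wall\<close>)
    qed
    show "wall i base_point \<noteq> 0"
      using i by (auto elim!: less_6E simp: wall_def base_point_def)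
    show "\<exists>r\<in>total_space. S q = Some r \<and> (\<forall>k<11. coord k r = (map N [0..<11] ! k) q / wall i q)"
      if "q \<in> total_space" "wall i q \<noteq> 0" for q
      using that by (simp add: simple_reflection_eq[OF S] move_total_space c N_def field_simps)
  qed (use i in \<open>simp_all add: polynomial_fun_wall base_point_in_total_space simple_reflection_eq[OF S]\<close>)
qed

lemma birational_simple_reflection:
  assumes "simple_reflection i S"
  shows "birational S"
  using assms by (intro birational_involution rational_simple_reflection simple_reflection_square)

section \<open>Relations between two simple reflections\<close>

text \<open>
  A word in two reflections stays within the four-parameter family of points with shifts
  supported on \<open>{i, j}\<close>.
\<close>
definition pair :: "nat \<Rightarrow> nat \<Rightarrow> complex \<Rightarrow> complex \<Rightarrow> nat \<Rightarrow> complex" where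
  "pair i j u v = (\<lambda>_. 0)(i := u, j := v)"

lemma pair_simps:
  "pair i j u v j = v" "i \<noteq> j \<Longrightarrow> pair i j u v i = u"
  "(pair i j u v)(j := c) = pair i j u c" "i \<noteq> j \<Longrightarrow> (pair i j u v)(i := c) = pair i j c v"
  by (auto simp: pair_def fun_eq_iff)

lemma pair_0: "pair i j 0 0 = (\<lambda>_. 0)"
  by (auto simp: pair_def)

lemma simple_reflection_pair:
  assumes S: "simple_reflection i S" and T: "simple_reflection j T" and ij: "i \<noteq> j"
    and q: "q = move p (pair i j u v) (pair i j m n)"
  shows "wall i q \<noteq> 0 \<Longrightarrow> S q = Some (move p (pair i j (u + root i q / wall i q) v) (pair i j (m + root i q) n))"
   and "wall j q \<noteq> 0 \<Longrightarrow> T q = Some (move p (pair i j u (v + root j q / wall j q)) (pair i j m (n + root j q)))"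
  unfolding q using simple_reflectionD[OF S] simple_reflectionD[OF T]
  by (simp_all only: pair_simps ij not_False_eq_True)

text \<open>
  For nodes that are not joined in the Dynkin diagram neither reflection changes the denominator
  or the root of the other, so they act independently, and each of them is an involution.
\<close>
lemma commutation_relation:
  assumes S: "simple_reflection i S" and T: "simple_reflection j T" and ij: "i \<noteq> j"
    and wr: "\<And>p u v m n. wall i (move p (pair i j u v) (pair i j m n)) = wall i p"
      "\<And>p u v m n. wall j (move p (pair i j u v) (pair i j m n)) = wall j p"
      "\<And>p u v m n. root i (move p (pair i j u v) (pair i j m n)) = root i p - 2 * m"
      "\<And>p u v m n. root j (move p (pair i j u v) (pair i j m n)) = root j p - 2 * n"
  shows "rat_power (S \<circ>\<^sub>m T) 2 \<approx> rat_id"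
proof (rule rat_eq_idI[of "\<lambda>p. wall i p * wall j p"])
  have i: "i < 6" "j < 6" using S T by (simp_all add: simple_reflection_def)
  then show "polynomial_fun (\<lambda>p. wall i p * wall j p)"
    by (intro polynomial_intros polynomial_fun_wall)
  show "wall i base_point * wall j base_point \<noteq> 0"
    using i by (auto elim!: less_6E simp: wall_def base_point_def)
  fix p assume g: "wall i p * wall j p \<noteq> 0"
  define Q where "Q u v m n = move p (pair i j u v) (pair i j m n)" for u v m n
  have steps: "S (Q u v m n) = Some (Q (u + (root i p - 2 * m) / wall i p) v (root i p - m) n)"
     "T (Q u v m n) = Some (Q u (v + (root j p - 2 * n) / wall j p) m (root j p - n))" for u v m n
    using g simple_reflection_pair[OF S T ij Q_def[of u v m n]] by (simp_all add: Q_def wr)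
  have "Q 0 0 0 0 = p" by (simp add: Q_def pair_0 move_0)
  moreover have "rat_power (S \<circ>\<^sub>m T) 2 (Q 0 0 0 0) = Some (Q 0 0 0 0)"
    by (simp add: numeral_2_eq_2 steps)
  ultimately show "rat_power (S \<circ>\<^sub>m T) 2 p = Some p" by simp
qed

text \<open>
  For joined nodes each direction changes the other denominator at unit rate, with opposite
  signs. Write \<open>f, h\<close> for the denominators and \<open>a, b\<close> for the roots at the starting point. Along
  the orbit the roots are, up to sign, \<open>b\<close>, \<open>a + b\<close>, \<open>a\<close>, \<open>b\<close>, \<open>a + b\<close>, \<open>a\<close>, the positive
  roots of type \<open>A\<^sub>2\<close> each met twice, and all denominators are quotients of products of
  the four polynomials \<open>f\<close>, \<open>h\<close>, \<open>A = f h - b\<close> and \<open>B = f h + a\<close>: they are, in order,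
  \<open>h\<close>, \<open>A / h\<close>, \<open>h B / A\<close>, \<open>f A / B\<close>, \<open>B / f\<close>, \<open>f\<close>. The orbit is therefore defined wherever
  these four do not vanish, and it closes after six steps.
\<close>
lemma braid_relation:
  assumes S: "simple_reflection i S" and T: "simple_reflection j T" and ij: "i \<noteq> j"
    and wr: "\<And>p u v m n. wall i (move p (pair i j u v) (pair i j m n)) = wall i p - v"
      "\<And>p u v m n. wall j (move p (pair i j u v) (pair i j m n)) = wall j p + u"
      "\<And>p u v m n. root i (move p (pair i j u v) (pair i j m n)) = root i p - 2 * m + n"
      "\<And>p u v m n. root j (move p (pair i j u v) (pair i j m n)) = root j p + m - 2 * n"
  shows "rat_power (S \<circ>\<^sub>m T) 3 \<approx> rat_id"
proof (rule rat_eq_idI[of "\<lambda>p. wall i p * wall j p * (wall i p * wall j p - root j p) * (wall i p * wall j p + root i p)"])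
  have i: "i < 6" "j < 6" using S T by (simp_all add: simple_reflection_def)
  then show "polynomial_fun (\<lambda>p. wall i p * wall j p * (wall i p * wall j p - root j p) * (wall i p * wall j p + root i p))"
    by (intro polynomial_intros polynomial_fun_wall) auto
  show "wall i base_point * wall j base_point * (wall i base_point * wall j base_point - root j base_point) *
      (wall i base_point * wall j base_point + root i base_point) \<noteq> 0"
    using i ij by (auto elim!: less_6E simp: wall_def base_point_def)
  fix p
  define f h a b where "f = wall i p" and "h = wall j p" and "a = root i p" and "b = root j p"
  define A B where "A = f * h - b" and "B = f * h + a"
  assume "wall i p * wall j p * (wall i p * wall j p - root j p) * (wall i p * wall j p + root i p) \<noteq> 0"
  then have nz: "f \<noteq> 0" "h \<noteq> 0" "A \<noteq> 0" "B \<noteq> 0"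
    by (auto simp: f_def h_def a_def b_def A_def B_def)
  define Q where "Q u v m n = move p (pair i j u v) (pair i j m n)" for u v m n
  have S_step: "S (Q u v m n) = Some (Q u' v (a - m + n) n)"
    if "f - v = c" "c \<noteq> 0" "u + (a - 2 * m + n) / c = u'" for u v m n c u'
    using that simple_reflection_pair(1)[OF S T ij refl, of p u v m n]
    unfolding Q_def wr f_def a_def by (simp add: algebra_simps)
  have T_step: "T (Q u v m n) = Some (Q u v' m (b + m - n))"
    if "h + u = c" "c \<noteq> 0" "v + (b + m - 2 * n) / c = v'" for u v m n c v'
    using that simple_reflection_pair(2)[OF S T ij refl, of p u v m n]
    unfolding Q_def wr h_def b_def by (simp add: algebra_simps)
  \<comment> \<open>The cancellations rest on \<open>B - A = a + b\<close> and \<open>a A + b B = (a + b) f h\<close>.\<close>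
  have "T (Q 0 0 0 0) = Some (Q 0 (b / h) 0 b)"
    using nz by (subst T_step[of _ h]) auto
  moreover have "S (Q 0 (b / h) 0 b) = Some (Q ((a + b) * h / A) (b / h) (a + b) b)"
    using nz by (subst S_step[of _ "A / h"]) (auto simp: A_def field_simps)
  moreover have "T (Q ((a + b) * h / A) (b / h) (a + b) b) = Some (Q ((a + b) * h / A) ((a + b) * f / B) (a + b) (a + b))"
    using nz by (subst T_step[of _ "h * B / A"]) (auto simp: field_simps, auto simp: A_def B_def field_simps)
  moreover have "S (Q ((a + b) * h / A) ((a + b) * f / B) (a + b) (a + b)) = Some (Q (a / f) ((a + b) * f / B) a (a + b))"
    using nz by (subst S_step[of _ "f * A / B"]) (auto simp: field_simps, auto simp: A_def B_def field_simps)
  moreover have "T (Q (a / f) ((a + b) * f / B) a (a + b)) = Some (Q (a / f) 0 a 0)"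
    using nz by (subst T_step[of _ "B / f"]) (auto simp: field_simps, auto simp: A_def B_def field_simps)
  moreover have "S (Q (a / f) 0 a 0) = Some (Q 0 0 0 0)"
    using nz by (subst S_step[of _ f]) (auto simp: field_simps)
  ultimately have "rat_power (S \<circ>\<^sub>m T) 3 (Q 0 0 0 0) = Some (Q 0 0 0 0)"
    by (simp add: numeral_3_eq_3)
  moreover have "Q 0 0 0 0 = p" by (simp add: Q_def pair_0 move_0)
  ultimately show "rat_power (S \<circ>\<^sub>m T) 3 p = Some p" by simp
qed

lemma commutation_relations:
  "(S, T) \<in> {(s0, s1), (s0, s3), (s0, s4), (s0, s5), (s1, s3), (s1, s4), (s1, s5),
      (s2, s4), (s2, s5), (s4, s5)} \<Longrightarrow> rat_power (S \<circ>\<^sub>m T) 2 \<approx> rat_id"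
  by (elim insertE emptyE; clarify; rule commutation_relation, (rule simple_reflections)+)
   (simp_all add: split_paired_all wall_def pair_def)

lemma braid_relations:
  "(S, T) \<in> {(s0, s2), (s1, s2), (s2, s3), (s3, s4), (s3, s5)} \<Longrightarrow> rat_power (S \<circ>\<^sub>m T) 3 \<approx> rat_id"
  by (elim insertE emptyE; clarify; rule braid_relation, (rule simple_reflections)+)
   (simp_all add: split_paired_all wall_def pair_def)

section \<open>The diagram automorphisms\<close>

lemma rational_pi1: "rational_map pi1"
proof (rule rational_mapI[of
    "[\<lambda>p. 1 - coord 0 p, \<lambda>p. - coord 1 p - coord 4 p, \<lambda>p. 1 - coord 2 p, \<lambda>p. - coord 3 p,
      \<lambda>p. coord 4 p, \<lambda>p. coord 6 p, \<lambda>p. coord 5 p, \<lambda>p. coord 7 p,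
      \<lambda>p. coord 8 p, \<lambda>p. coord 10 p, \<lambda>p. coord 9 p]"
    "\<lambda>_. 1 :: complex" base_point], goal_cases)
  case (6 q)
  then show ?case by (cases q rule: point_cases) simp
next
  case (7 q)
  then show ?case
    by (cases q rule: point_cases)
      (auto elim!: less_11E simp: total_space_def parameter_space_def algebra_simps)
qed (auto intro!: polynomial_intros simp: base_point_in_total_space[unfolded base_point_def] base_point_def)

lemma pi1_square: "rat_power pi1 2 \<approx> rat_id"
proof (rule rat_eq_idI[of "\<lambda>_. 1 :: complex"])
  fix p assume "(\<lambda>_. 1 :: complex) p \<noteq> 0"
  then show "rat_power pi1 2 p = Some p"
    by (cases p rule: point_cases) (simp add: numeral_2_eq_2 field_simps)
qed (auto intro!: polynomial_intros simp: base_point_def)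

lemma rational_pi2: "rational_map pi2"
proof (rule rational_mapI[of
    "[\<lambda>p. coord 1 p + coord 3 p + coord 4 p, \<lambda>p. (- coord 4 p * (coord 2 p - 1)) * coord 4 p, \<lambda>p. coord 1 p + coord 4 p, \<lambda>p. (- coord 4 p * (coord 0 p - coord 2 p)) * coord 4 p,
      \<lambda>p. - coord 4 p * coord 4 p, \<lambda>p. coord 10 p * coord 4 p, \<lambda>p. coord 9 p * coord 4 p, \<lambda>p. coord 8 p * coord 4 p,
      \<lambda>p. coord 7 p * coord 4 p, \<lambda>p. coord 6 p * coord 4 p, \<lambda>p. coord 5 p * coord 4 p]"
    "coord 4" base_point], goal_cases)
  case (6 q)
  then show ?case by (cases q rule: point_cases) simp
next
  case (7 q)
  then show ?case
    by (cases q rule: point_cases)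
      (auto elim!: less_11E simp: total_space_def parameter_space_def field_simps)
qed (auto intro!: polynomial_intros simp: base_point_in_total_space[unfolded base_point_def] base_point_def)

lemma pi2_square: "rat_power pi2 2 \<approx> rat_id"
proof (rule rat_eq_idI[of "coord 4"])
  fix p assume "(coord 4) p \<noteq> 0"
  then show "rat_power pi2 2 p = Some p"
    by (cases p rule: point_cases) (simp add: numeral_2_eq_2 field_simps)
qed (auto intro!: polynomial_intros simp: base_point_def)

lemma rational_pi3: "rational_map pi3"
proof (rule rational_mapI[of
    "[\<lambda>p. 1 - coord 0 p, \<lambda>p. - coord 1 p, \<lambda>p. 1 - coord 2 p, \<lambda>p. - coord 3 p,
      \<lambda>p. - coord 4 p, \<lambda>p. coord 5 p, \<lambda>p. coord 6 p, \<lambda>p. coord 7 p,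
      \<lambda>p. coord 8 p, \<lambda>p. coord 10 p, \<lambda>p. coord 9 p]"
    "\<lambda>_. 1 :: complex" base_point], goal_cases)
  case (6 q)
  then show ?case by (cases q rule: point_cases) simp
next
  case (7 q)
  then show ?case
    by (cases q rule: point_cases)
      (auto elim!: less_11E simp: total_space_def parameter_space_def algebra_simps)
qed (auto intro!: polynomial_intros simp: base_point_in_total_space[unfolded base_point_def] base_point_def)

lemma pi3_square: "rat_power pi3 2 \<approx> rat_id"
proof (rule rat_eq_idI[of "\<lambda>_. 1 :: complex"])
  fix p assume "(\<lambda>_. 1 :: complex) p \<noteq> 0"
  then show "rat_power pi3 2 p = Some p"
    by (cases p rule: point_cases) (simp add: numeral_2_eq_2 field_simps)
qed (auto intro!: polynomial_intros simp: base_point_def)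

lemma rational_pi4: "rational_map pi4"
proof (rule rational_mapI[of
    "[\<lambda>p. coord 0 p, \<lambda>p. coord 1 p + coord 4 p, \<lambda>p. coord 2 p, \<lambda>p. coord 3 p,
      \<lambda>p. - coord 4 p, \<lambda>p. coord 6 p, \<lambda>p. coord 5 p, \<lambda>p. coord 7 p,
      \<lambda>p. coord 8 p, \<lambda>p. coord 9 p, \<lambda>p. coord 10 p]"
    "\<lambda>_. 1 :: complex" base_point], goal_cases)
  case (6 q)
  then show ?case by (cases q rule: point_cases) simp
next
  case (7 q)
  then show ?case
    by (cases q rule: point_cases)
      (auto elim!: less_11E simp: total_space_def parameter_space_def algebra_simps)
qed (auto intro!: polynomial_intros simp: base_point_in_total_space[unfolded base_point_def] base_point_def)

lemma pi4_square: "rat_power pi4 2 \<approx> rat_id"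
proof (rule rat_eq_idI[of "\<lambda>_. 1 :: complex"])
  fix p assume "(\<lambda>_. 1 :: complex) p \<noteq> 0"
  then show "rat_power pi4 2 p = Some p"
    by (cases p rule: point_cases) (simp add: numeral_2_eq_2 field_simps)
qed (auto intro!: polynomial_intros simp: base_point_def)

section \<open>From identities between vector fields to transformed solutions\<close>

text \<open>
  In every generator the new independent variable is \<open>\<sigma> t\<close> with \<open>\<sigma> = 1\<close> or \<open>\<sigma> = -1\<close>. As \<open>\<sigma>\<close> is
  its own inverse, the transformed solution is the function
  \<open>\<tau> \<mapsto> (X, Y, Z, W) (p (\<sigma> \<tau>))\<close>, where \<open>p t\<close> is the given solution; the factor \<open>\<sigma>\<close> in the
  derivatives is the one produced by the chain rule.
\<close>

lemma baecklund_transformationI: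
  fixes \<sigma> :: complex
  assumes bir: "birational T"
    and \<sigma>: "\<sigma> * \<sigma> = 1"
    and T: "\<And>x y z w t \<alpha>. T (x, y, z, w, t, \<alpha>) \<noteq> None \<Longrightarrow> T (x, y, z, w, t, \<alpha>) =
      Some (X (x, y, z, w, t, \<alpha>), Y (x, y, z, w, t, \<alpha>), Z (x, y, z, w, t, \<alpha>), W (x, y, z, w, t, \<alpha>), \<sigma> * t, A \<alpha>)"
    and A: "\<And>\<alpha>. \<alpha> \<in> parameter_space \<Longrightarrow> A \<alpha> \<in> parameter_space"
    and deriv: "\<And>x y z w t a0 a1 a2 a3 a4 a5 \<alpha> p q. \<lbrakk>\<alpha> = (a0, a1, a2, a3, a4, a5);
       p = (x t, y t, z t, w t, t, a0, a1, a2, a3, a4, a5); p \<in> total_space; t \<noteq> 0; T p = Some q;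
       (x has_field_derivative rhs_x p) (at t); (y has_field_derivative rhs_y p) (at t);
       (z has_field_derivative rhs_z p) (at t); (w has_field_derivative rhs_w p) (at t)\<rbrakk> \<Longrightarrow>
       ((\<lambda>s. X (x s, y s, z s, w s, s, \<alpha>)) has_field_derivative \<sigma> * rhs_x q) (at t) \<and>
       ((\<lambda>s. Y (x s, y s, z s, w s, s, \<alpha>)) has_field_derivative \<sigma> * rhs_y q) (at t) \<and>
       ((\<lambda>s. Z (x s, y s, z s, w s, s, \<alpha>)) has_field_derivative \<sigma> * rhs_z q) (at t) \<and>
       ((\<lambda>s. W (x s, y s, z s, w s, s, \<alpha>)) has_field_derivative \<sigma> * rhs_w q) (at t)"
  shows "baecklund_transformation T"
  unfolding baecklund_transformation_def
proof (intro conjI allI impI bir, elim conjE)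
  fix D x y z w \<alpha>
  assume sol: "solution D x y z w \<alpha>" and dom: "\<forall>t\<in>D. T (x t, y t, z t, w t, t, \<alpha>) \<noteq> None"
  have \<sigma>0: "\<sigma> \<noteq> 0" using \<sigma> by auto
  have inv: "\<sigma> * (\<sigma> * t) = t" for t using \<sigma> by (metis mult.assoc mult_1)
  define p where "p t = (x t, y t, z t, w t, t, \<alpha>)" for t
  define U where "U G \<tau> = G (p (\<sigma> * \<tau>))" for G :: "point \<Rightarrow> complex" and \<tau>
  have pull: "(U G has_field_derivative d) (at (\<sigma> * t))"
    if "((\<lambda>s. G (x s, y s, z s, w s, s, \<alpha>)) has_field_derivative \<sigma> * d) (at t)" for G d t
  proof -
    have "((\<lambda>\<tau>. G (p (\<sigma> * \<tau>))) has_field_derivative \<sigma> * d * \<sigma>) (at (\<sigma> * t))"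
      by (rule DERIV_chain2[of "\<lambda>s. G (p s)"])
        (use that in \<open>auto simp: inv p_def intro!: derivative_eq_intros\<close>)
    moreover have "\<sigma> * d * \<sigma> = d" using \<sigma> by algebra
    ultimately show ?thesis by (simp add: U_def[abs_def])
  qed
  have Tp: "T (p t) = Some (U X (\<sigma> * t), U Y (\<sigma> * t), U Z (\<sigma> * t), U W (\<sigma> * t), \<sigma> * t, A \<alpha>)"
    if "t \<in> D" for t
    using T dom that by (simp add: U_def p_def inv)
  have "open ((*) \<sigma> ` D)"
    using sol \<sigma>0 by (intro open_times_image) (simp_all add: solution_def)
  moreover have "0 \<notin> (*) \<sigma> ` D" "A \<alpha> \<in> parameter_space"
    using sol \<sigma>0 A by (auto simp: solution_def)
  moreover have "(U X has_field_derivative rhs_x (the (T (p t)))) (at (\<sigma> * t)) \<and>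
      (U Y has_field_derivative rhs_y (the (T (p t)))) (at (\<sigma> * t)) \<and>
      (U Z has_field_derivative rhs_z (the (T (p t)))) (at (\<sigma> * t)) \<and>
      (U W has_field_derivative rhs_w (the (T (p t)))) (at (\<sigma> * t))" if "t \<in> D" for t
  proof -
    obtain a0 a1 a2 a3 a4 a5 where \<alpha>: "\<alpha> = (a0, a1, a2, a3, a4, a5)" by (cases \<alpha>)
    have "p t \<in> total_space" "t \<noteq> 0"
      using sol that by (auto simp: solution_def p_def total_space_def)
    then show ?thesis
      using deriv[of \<alpha> a0 a1 a2 a3 a4 a5 "p t" x t y z w "the (T (p t))"] sol dom that
      by (auto simp: solution_def p_def \<alpha> intro!: pull)
  qed
  ultimately have "solution ((*) \<sigma> ` D) (U X) (U Y) (U Z) (U W) (A \<alpha>)"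
    using Tp by (auto simp: solution_def)
  with Tp show "\<exists>\<tau> x' y' z' w' \<alpha>'. solution (\<tau> ` D) x' y' z' w' \<alpha>' \<and>
      (\<forall>t\<in>D. T (x t, y t, z t, w t, t, \<alpha>) =
         Some (x' (\<tau> t), y' (\<tau> t), z' (\<tau> t), w' (\<tau> t), \<tau> t, \<alpha>'))"
    unfolding p_def by blast
qed

section \<open>The vector field under the generators\<close>

text \<open>
  The Baecklund property of a map is an identity between rational functions: at the image \<open>q\<close> of a
  point \<open>p\<close>, the right-hand side of the system with the new parameters is the image of the
  right-hand side at \<open>p\<close> under the differential of the map. For \<open>s\<^sub>i\<close> the differential contributes
  the derivative of \<open>\<alpha>\<^sub>i / f\<^sub>i\<close>, that is \<open>- \<alpha>\<^sub>i f\<^sub>i' / f\<^sub>i\<^sup>2\<close> where \<open>f\<^sub>i'\<close> is the derivative of the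
  denominator \<open>f\<^sub>i\<close> along the flow; for \<open>s\<^sub>0\<close> it includes the derivative of the explicit \<open>t\<close>. As \<open>\<alpha>\<^sub>0\<close> does not
  occur in the system, the normalisation of the parameters enters exactly for the generators whose
  new \<open>\<alpha>\<^sub>1, \<dots>, \<alpha>\<^sub>5\<close> involve it: \<open>s\<^sub>0\<close>, \<open>\<pi>\<^sub>1\<close>, \<open>\<pi>\<^sub>2\<close> and \<open>\<pi>\<^sub>4\<close>. Where \<open>f\<^sub>i\<close> is not a coordinate,
  a coordinate is eliminated in favour of \<open>F = f\<^sub>i\<close>, so that only \<open>t\<close> and the single variable
  \<open>F\<close> occur in denominators and clearing them leaves polynomial identities.
\<close>

lemma rhs_s0:
  assumes p: "p = (x, y, z, w, t, a0, a1, a2, a3, a4, a5)" and total: "p \<in> total_space" and t: "t \<noteq> 0" and wall: "y + t \<noteq> 0"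
    and q: "q = (x + a0 / (y + t), y, z, w, t, - a0, a1, a2 + a0, a3, a4, a5)"
  shows "rhs_x q = rhs_x p - a0 * (rhs_y p + 1) / (y + t)^2"
    and "rhs_y q = rhs_y p"
    and "rhs_z q = rhs_z p"
    and "rhs_w q = rhs_w p"
proof -
  have a1: "a1 = 1 - a0 - 2 * a2 - 2 * a3 - a4 - a5"
    using total unfolding p by (simp add: total_space_def parameter_space_def algebra_simps)
  obtain F where F: "F \<noteq> 0" "y = F - t"
    using wall that[of "y + t"] by simp
  show "rhs_x q = rhs_x p - a0 * (rhs_y p + 1) / (y + t)^2"
    "rhs_y q = rhs_y p"
    "rhs_z q = rhs_z p"
    "rhs_w q = rhs_w p"
    using t F(1) unfolding p q a1 F(2) rhs_x.simps rhs_y.simps rhs_z.simps rhs_w.simps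
    by (simp_all add: field_simps power2_eq_square)
qed

lemma rhs_s1:
  assumes p: "p = (x, y, z, w, t, a0, a1, a2, a3, a4, a5)" and t: "t \<noteq> 0" and wall: "y \<noteq> 0"
    and q: "q = (x + a1 / y, y, z, w, t, a0, - a1, a2 + a1, a3, a4, a5)"
  shows "rhs_x q = rhs_x p - a1 * rhs_y p / y^2"
    and "rhs_y q = rhs_y p"
    and "rhs_z q = rhs_z p"
    and "rhs_w q = rhs_w p"
  using t wall unfolding p q rhs_x.simps rhs_y.simps rhs_z.simps rhs_w.simps
  by (simp_all add: field_simps power2_eq_square)

lemma rhs_s2:
  assumes p: "p = (x, y, z, w, t, a0, a1, a2, a3, a4, a5)" and t: "t \<noteq> 0" and wall: "x - z \<noteq> 0"
    and q: "q = (x, y - a2 / (x - z), z, w + a2 / (x - z), t, a0 + a2, a1 + a2, - a2, a3 + a2, a4, a5)"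
  shows "rhs_x q = rhs_x p"
    and "rhs_y q = rhs_y p + a2 * (rhs_x p - rhs_z p) / (x - z)^2"
    and "rhs_z q = rhs_z p"
    and "rhs_w q = rhs_w p - a2 * (rhs_x p - rhs_z p) / (x - z)^2"
proof -
  obtain F where F: "F \<noteq> 0" "x = F + z"
    using wall that[of "x - z"] by simp
  show "rhs_x q = rhs_x p"
    "rhs_y q = rhs_y p + a2 * (rhs_x p - rhs_z p) / (x - z)^2"
    "rhs_z q = rhs_z p"
    "rhs_w q = rhs_w p - a2 * (rhs_x p - rhs_z p) / (x - z)^2"
    using t F(1) unfolding p q F(2) rhs_x.simps rhs_y.simps rhs_z.simps rhs_w.simps
    by (simp_all add: field_simps power2_eq_square)
qed

lemma rhs_s3:
  assumes p: "p = (x, y, z, w, t, a0, a1, a2, a3, a4, a5)" and t: "t \<noteq> 0" and wall: "w \<noteq> 0"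
    and q: "q = (x, y, z + a3 / w, w, t, a0, a1, a2 + a3, - a3, a4 + a3, a5 + a3)"
  shows "rhs_x q = rhs_x p"
    and "rhs_y q = rhs_y p"
    and "rhs_z q = rhs_z p - a3 * rhs_w p / w^2"
    and "rhs_w q = rhs_w p"
  using t wall unfolding p q rhs_x.simps rhs_y.simps rhs_z.simps rhs_w.simps
  by (simp_all add: field_simps power2_eq_square)

lemma rhs_s4:
  assumes p: "p = (x, y, z, w, t, a0, a1, a2, a3, a4, a5)" and t: "t \<noteq> 0" and wall: "z - 1 \<noteq> 0"
    and q: "q = (x, y, z, w - a4 / (z - 1), t, a0, a1, a2, a3 + a4, - a4, a5)"
  shows "rhs_x q = rhs_x p"
    and "rhs_y q = rhs_y p"
    and "rhs_z q = rhs_z p"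
    and "rhs_w q = rhs_w p + a4 * rhs_z p / (z - 1)^2"
proof -
  obtain F where F: "F \<noteq> 0" "z = F + 1"
    using wall that[of "z - 1"] by simp
  show "rhs_x q = rhs_x p"
    "rhs_y q = rhs_y p"
    "rhs_z q = rhs_z p"
    "rhs_w q = rhs_w p + a4 * rhs_z p / (z - 1)^2"
    using t F(1) unfolding p q F(2) rhs_x.simps rhs_y.simps rhs_z.simps rhs_w.simps
    by (simp_all add: field_simps power2_eq_square)
qed

lemma rhs_s5:
  assumes p: "p = (x, y, z, w, t, a0, a1, a2, a3, a4, a5)" and t: "t \<noteq> 0" and wall: "z \<noteq> 0"
    and q: "q = (x, y, z, w - a5 / z, t, a0, a1, a2, a3 + a5, a4, - a5)"
  shows "rhs_x q = rhs_x p"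
    and "rhs_y q = rhs_y p"
    and "rhs_z q = rhs_z p"
    and "rhs_w q = rhs_w p + a5 * rhs_z p / z^2"
  using t wall unfolding p q rhs_x.simps rhs_y.simps rhs_z.simps rhs_w.simps
  by (simp_all add: field_simps power2_eq_square)

lemma rhs_pi1:
  assumes p: "p = (x, y, z, w, t, a0, a1, a2, a3, a4, a5)" and total: "p \<in> total_space" and t: "t \<noteq> 0"
    and q: "q = (1 - x, - y - t, 1 - z, - w, t, a1, a0, a2, a3, a5, a4)"
  shows "rhs_x q = - rhs_x p"
    and "rhs_y q = - rhs_y p - 1"
    and "rhs_z q = - rhs_z p"
    and "rhs_w q = - rhs_w p"
proof -
  have a0: "a0 = 1 - a1 - 2 * a2 - 2 * a3 - a4 - a5"
    using total unfolding p by (simp add: total_space_def parameter_space_def algebra_simps)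
  show "rhs_x q = - rhs_x p"
    "rhs_y q = - rhs_y p - 1"
    "rhs_z q = - rhs_z p"
    "rhs_w q = - rhs_w p"
    using t unfolding p q a0 rhs_x.simps rhs_y.simps rhs_z.simps rhs_w.simps
    by (simp_all add: field_simps power2_eq_square)
qed

lemma rhs_pi2:
  assumes p: "p = (x, y, z, w, t, a0, a1, a2, a3, a4, a5)" and total: "p \<in> total_space" and t: "t \<noteq> 0"
    and q: "q = ((y + w + t) / t, - t * (z - 1), (y + t) / t, - t * (x - z), - t, a5, a4, a3, a2, a1, a0)"
  shows "rhs_x q = (y + w + t) / t^2 - (rhs_y p + rhs_w p + 1) / t"
    and "rhs_y q = z - 1 + t * rhs_z p"
    and "rhs_z q = (y + t) / t^2 - (rhs_y p + 1) / t"
    and "rhs_w q = x - z + t * (rhs_x p - rhs_z p)"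
proof -
  have a0: "a0 = 1 - a1 - 2 * a2 - 2 * a3 - a4 - a5"
    using total unfolding p by (simp add: total_space_def parameter_space_def algebra_simps)
  show "rhs_x q = (y + w + t) / t^2 - (rhs_y p + rhs_w p + 1) / t"
    "rhs_y q = z - 1 + t * rhs_z p"
    "rhs_z q = (y + t) / t^2 - (rhs_y p + 1) / t"
    "rhs_w q = x - z + t * (rhs_x p - rhs_z p)"
    using t unfolding p q a0 rhs_x.simps rhs_y.simps rhs_z.simps rhs_w.simps
    by (simp_all add: field_simps power2_eq_square)
qed

lemma rhs_pi3:
  assumes p: "p = (x, y, z, w, t, a0, a1, a2, a3, a4, a5)" and t: "t \<noteq> 0"
    and q: "q = (1 - x, - y, 1 - z, - w, - t, a0, a1, a2, a3, a5, a4)"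
  shows "rhs_x q = rhs_x p"
    and "rhs_y q = rhs_y p"
    and "rhs_z q = rhs_z p"
    and "rhs_w q = rhs_w p"
  using t unfolding p q rhs_x.simps rhs_y.simps rhs_z.simps rhs_w.simps
  by (simp_all add: field_simps power2_eq_square)

lemma rhs_pi4:
  assumes p: "p = (x, y, z, w, t, a0, a1, a2, a3, a4, a5)" and total: "p \<in> total_space" and t: "t \<noteq> 0"
    and q: "q = (x, y + t, z, w, - t, a1, a0, a2, a3, a4, a5)"
  shows "rhs_x q = - rhs_x p"
    and "rhs_y q = - rhs_y p - 1"
    and "rhs_z q = - rhs_z p"
    and "rhs_w q = - rhs_w p"
proof -
  have a0: "a0 = 1 - a1 - 2 * a2 - 2 * a3 - a4 - a5"
    using total unfolding p by (simp add: total_space_def parameter_space_def algebra_simps)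
  show "rhs_x q = - rhs_x p"
    "rhs_y q = - rhs_y p - 1"
    "rhs_z q = - rhs_z p"
    "rhs_w q = - rhs_w p"
    using t unfolding p q a0 rhs_x.simps rhs_y.simps rhs_z.simps rhs_w.simps
    by (simp_all add: field_simps power2_eq_square)
qed

section \<open>The generators are Baecklund transformations\<close>

lemmas birational_generators =
  simple_reflections[THEN birational_simple_reflection]
  birational_involution[OF rational_pi1 pi1_square] birational_involution[OF rational_pi2 pi2_square]
  birational_involution[OF rational_pi3 pi3_square] birational_involution[OF rational_pi4 pi4_square]

text \<open>
  In each case the quotient rule expresses the derivatives of the transformed functions through
  those of the given solution, and the result is the right-hand side computed above.
\<close>

lemma baecklund_s0: "baecklund_transformation s0"
proof (rule baecklund_transformationI[of s0 "1"
    "\<lambda>(x, y, z, w, t, a0, a1, a2, a3, a4, a5). x + a0 / (y + t)"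
    "\<lambda>(x, y, z, w, t, a0, a1, a2, a3, a4, a5). y"
    "\<lambda>(x, y, z, w, t, a0, a1, a2, a3, a4, a5). z"
    "\<lambda>(x, y, z, w, t, a0, a1, a2, a3, a4, a5). w"
    "\<lambda>(a0, a1, a2, a3, a4, a5). (- a0, a1, a2 + a0, a3, a4, a5)"], goal_cases)
  case (5 x y z w t a0 a1 a2 a3 a4 a5 \<alpha> p q)
  have q: "q = (x t + a0 / (y t + t), y t, z t, w t, t, - a0, a1, a2 + a0, a3, a4, a5)"
    and wall: "y t + t \<noteq> 0"
    using 5(2,4,5) by (auto split: if_splits)
  show ?case
    using 5(4,6-9) wall unfolding rhs_s0[OF 5(2-4) wall q] 5(1)
    by (auto simp: power2_eq_square simp del: rhs_x.simps rhs_y.simps rhs_z.simps rhs_w.simps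
        intro!: derivative_eq_intros)
qed (auto simp: birational_generators parameter_space_def algebra_simps split: if_splits)

lemma baecklund_s1: "baecklund_transformation s1"
proof (rule baecklund_transformationI[of s1 "1"
    "\<lambda>(x, y, z, w, t, a0, a1, a2, a3, a4, a5). x + a1 / y"
    "\<lambda>(x, y, z, w, t, a0, a1, a2, a3, a4, a5). y"
    "\<lambda>(x, y, z, w, t, a0, a1, a2, a3, a4, a5). z"
    "\<lambda>(x, y, z, w, t, a0, a1, a2, a3, a4, a5). w"
    "\<lambda>(a0, a1, a2, a3, a4, a5). (a0, - a1, a2 + a1, a3, a4, a5)"], goal_cases)
  case (5 x y z w t a0 a1 a2 a3 a4 a5 \<alpha> p q)
  have q: "q = (x t + a1 / y t, y t, z t, w t, t, a0, - a1, a2 + a1, a3, a4, a5)"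
    and wall: "y t \<noteq> 0"
    using 5(2,4,5) by (auto split: if_splits)
  show ?case
    using 5(4,6-9) wall unfolding rhs_s1[OF 5(2,4) wall q] 5(1)
    by (auto simp: power2_eq_square simp del: rhs_x.simps rhs_y.simps rhs_z.simps rhs_w.simps
        intro!: derivative_eq_intros)
qed (auto simp: birational_generators parameter_space_def algebra_simps split: if_splits)

lemma baecklund_s2: "baecklund_transformation s2"
proof (rule baecklund_transformationI[of s2 "1"
    "\<lambda>(x, y, z, w, t, a0, a1, a2, a3, a4, a5). x"
    "\<lambda>(x, y, z, w, t, a0, a1, a2, a3, a4, a5). y - a2 / (x - z)"
    "\<lambda>(x, y, z, w, t, a0, a1, a2, a3, a4, a5). z"
    "\<lambda>(x, y, z, w, t, a0, a1, a2, a3, a4, a5). w + a2 / (x - z)"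
    "\<lambda>(a0, a1, a2, a3, a4, a5). (a0 + a2, a1 + a2, - a2, a3 + a2, a4, a5)"], goal_cases)
  case (5 x y z w t a0 a1 a2 a3 a4 a5 \<alpha> p q)
  have q: "q = (x t, y t - a2 / (x t - z t), z t, w t + a2 / (x t - z t), t, a0 + a2, a1 + a2, - a2, a3 + a2, a4, a5)"
    and wall: "x t - z t \<noteq> 0"
    using 5(2,4,5) by (auto split: if_splits)
  show ?case
    using 5(4,6-9) wall unfolding rhs_s2[OF 5(2,4) wall q] 5(1)
    by (auto simp: power2_eq_square simp del: rhs_x.simps rhs_y.simps rhs_z.simps rhs_w.simps
        intro!: derivative_eq_intros)
qed (auto simp: birational_generators parameter_space_def algebra_simps split: if_splits)

lemma baecklund_s3: "baecklund_transformation s3"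
proof (rule baecklund_transformationI[of s3 "1"
    "\<lambda>(x, y, z, w, t, a0, a1, a2, a3, a4, a5). x"
    "\<lambda>(x, y, z, w, t, a0, a1, a2, a3, a4, a5). y"
    "\<lambda>(x, y, z, w, t, a0, a1, a2, a3, a4, a5). z + a3 / w"
    "\<lambda>(x, y, z, w, t, a0, a1, a2, a3, a4, a5). w"
    "\<lambda>(a0, a1, a2, a3, a4, a5). (a0, a1, a2 + a3, - a3, a4 + a3, a5 + a3)"], goal_cases)
  case (5 x y z w t a0 a1 a2 a3 a4 a5 \<alpha> p q)
  have q: "q = (x t, y t, z t + a3 / w t, w t, t, a0, a1, a2 + a3, - a3, a4 + a3, a5 + a3)"
    and wall: "w t \<noteq> 0"
    using 5(2,4,5) by (auto split: if_splits)
  show ?case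
    using 5(4,6-9) wall unfolding rhs_s3[OF 5(2,4) wall q] 5(1)
    by (auto simp: power2_eq_square simp del: rhs_x.simps rhs_y.simps rhs_z.simps rhs_w.simps
        intro!: derivative_eq_intros)
qed (auto simp: birational_generators parameter_space_def algebra_simps split: if_splits)

lemma baecklund_s4: "baecklund_transformation s4"
proof (rule baecklund_transformationI[of s4 "1"
    "\<lambda>(x, y, z, w, t, a0, a1, a2, a3, a4, a5). x"
    "\<lambda>(x, y, z, w, t, a0, a1, a2, a3, a4, a5). y"
    "\<lambda>(x, y, z, w, t, a0, a1, a2, a3, a4, a5). z"
    "\<lambda>(x, y, z, w, t, a0, a1, a2, a3, a4, a5). w - a4 / (z - 1)"
    "\<lambda>(a0, a1, a2, a3, a4, a5). (a0, a1, a2, a3 + a4, - a4, a5)"], goal_cases)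
  case (5 x y z w t a0 a1 a2 a3 a4 a5 \<alpha> p q)
  have q: "q = (x t, y t, z t, w t - a4 / (z t - 1), t, a0, a1, a2, a3 + a4, - a4, a5)"
    and wall: "z t - 1 \<noteq> 0"
    using 5(2,4,5) by (auto split: if_splits)
  show ?case
    using 5(4,6-9) wall unfolding rhs_s4[OF 5(2,4) wall q] 5(1)
    by (auto simp: power2_eq_square simp del: rhs_x.simps rhs_y.simps rhs_z.simps rhs_w.simps
        intro!: derivative_eq_intros)
qed (auto simp: birational_generators parameter_space_def algebra_simps split: if_splits)

lemma baecklund_s5: "baecklund_transformation s5"
proof (rule baecklund_transformationI[of s5 "1"
    "\<lambda>(x, y, z, w, t, a0, a1, a2, a3, a4, a5). x"
    "\<lambda>(x, y, z, w, t, a0, a1, a2, a3, a4, a5). y"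
    "\<lambda>(x, y, z, w, t, a0, a1, a2, a3, a4, a5). z"
    "\<lambda>(x, y, z, w, t, a0, a1, a2, a3, a4, a5). w - a5 / z"
    "\<lambda>(a0, a1, a2, a3, a4, a5). (a0, a1, a2, a3 + a5, a4, - a5)"], goal_cases)
  case (5 x y z w t a0 a1 a2 a3 a4 a5 \<alpha> p q)
  have q: "q = (x t, y t, z t, w t - a5 / z t, t, a0, a1, a2, a3 + a5, a4, - a5)"
    and wall: "z t \<noteq> 0"
    using 5(2,4,5) by (auto split: if_splits)
  show ?case
    using 5(4,6-9) wall unfolding rhs_s5[OF 5(2,4) wall q] 5(1)
    by (auto simp: power2_eq_square simp del: rhs_x.simps rhs_y.simps rhs_z.simps rhs_w.simps
        intro!: derivative_eq_intros)
qed (auto simp: birational_generators parameter_space_def algebra_simps split: if_splits)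

lemma baecklund_pi1: "baecklund_transformation pi1"
proof (rule baecklund_transformationI[of pi1 "1"
    "\<lambda>(x, y, z, w, t, a0, a1, a2, a3, a4, a5). 1 - x"
    "\<lambda>(x, y, z, w, t, a0, a1, a2, a3, a4, a5). - y - t"
    "\<lambda>(x, y, z, w, t, a0, a1, a2, a3, a4, a5). 1 - z"
    "\<lambda>(x, y, z, w, t, a0, a1, a2, a3, a4, a5). - w"
    "\<lambda>(a0, a1, a2, a3, a4, a5). (a1, a0, a2, a3, a5, a4)"], goal_cases)
  case (5 x y z w t a0 a1 a2 a3 a4 a5 \<alpha> p q)
  have q: "q = (1 - x t, - y t - t, 1 - z t, - w t, t, a1, a0, a2, a3, a5, a4)"
    using 5(2,4,5) by (auto split: if_splits)
  show ?case
    using 5(4,6-9) unfolding rhs_pi1[OF 5(2-4) q] 5(1)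
    by (auto simp: power2_eq_square simp del: rhs_x.simps rhs_y.simps rhs_z.simps rhs_w.simps
        intro!: derivative_eq_intros)
qed (auto simp: birational_generators parameter_space_def algebra_simps split: if_splits)

lemma baecklund_pi2: "baecklund_transformation pi2"
proof (rule baecklund_transformationI[of pi2 "-1"
    "\<lambda>(x, y, z, w, t, a0, a1, a2, a3, a4, a5). (y + w + t) / t"
    "\<lambda>(x, y, z, w, t, a0, a1, a2, a3, a4, a5). - t * (z - 1)"
    "\<lambda>(x, y, z, w, t, a0, a1, a2, a3, a4, a5). (y + t) / t"
    "\<lambda>(x, y, z, w, t, a0, a1, a2, a3, a4, a5). - t * (x - z)"
    "\<lambda>(a0, a1, a2, a3, a4, a5). (a5, a4, a3, a2, a1, a0)"], goal_cases)
  case (5 x y z w t a0 a1 a2 a3 a4 a5 \<alpha> p q)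
  have q: "q = ((y t + w t + t) / t, - t * (z t - 1), (y t + t) / t, - t * (x t - z t), - t, a5, a4, a3, a2, a1, a0)"
    using 5(2,4,5) by (auto split: if_splits)
  show ?case
    using 5(4,6-9) unfolding rhs_pi2[OF 5(2-4) q] 5(1)
    by (auto simp: power2_eq_square field_simps simp del: rhs_x.simps rhs_y.simps rhs_z.simps rhs_w.simps
        intro!: derivative_eq_intros)
qed (auto simp: birational_generators parameter_space_def algebra_simps split: if_splits)

lemma baecklund_pi3: "baecklund_transformation pi3"
proof (rule baecklund_transformationI[of pi3 "-1"
    "\<lambda>(x, y, z, w, t, a0, a1, a2, a3, a4, a5). 1 - x"
    "\<lambda>(x, y, z, w, t, a0, a1, a2, a3, a4, a5). - y"
    "\<lambda>(x, y, z, w, t, a0, a1, a2, a3, a4, a5). 1 - z"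
    "\<lambda>(x, y, z, w, t, a0, a1, a2, a3, a4, a5). - w"
    "\<lambda>(a0, a1, a2, a3, a4, a5). (a0, a1, a2, a3, a5, a4)"], goal_cases)
  case (5 x y z w t a0 a1 a2 a3 a4 a5 \<alpha> p q)
  have q: "q = (1 - x t, - y t, 1 - z t, - w t, - t, a0, a1, a2, a3, a5, a4)"
    using 5(2,4,5) by (auto split: if_splits)
  show ?case
    using 5(4,6-9) unfolding rhs_pi3[OF 5(2,4) q] 5(1)
    by (auto simp: power2_eq_square simp del: rhs_x.simps rhs_y.simps rhs_z.simps rhs_w.simps
        intro!: derivative_eq_intros)
qed (auto simp: birational_generators parameter_space_def algebra_simps split: if_splits)

lemma baecklund_pi4: "baecklund_transformation pi4"
proof (rule baecklund_transformationI[of pi4 "-1"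
    "\<lambda>(x, y, z, w, t, a0, a1, a2, a3, a4, a5). x"
    "\<lambda>(x, y, z, w, t, a0, a1, a2, a3, a4, a5). y + t"
    "\<lambda>(x, y, z, w, t, a0, a1, a2, a3, a4, a5). z"
    "\<lambda>(x, y, z, w, t, a0, a1, a2, a3, a4, a5). w"
    "\<lambda>(a0, a1, a2, a3, a4, a5). (a1, a0, a2, a3, a4, a5)"], goal_cases)
  case (5 x y z w t a0 a1 a2 a3 a4 a5 \<alpha> p q)
  have q: "q = (x t, y t + t, z t, w t, - t, a1, a0, a2, a3, a4, a5)"
    using 5(2,4,5) by (auto split: if_splits)
  show ?case
    using 5(4,6-9) unfolding rhs_pi4[OF 5(2-4) q] 5(1)
    by (auto simp: power2_eq_square simp del: rhs_x.simps rhs_y.simps rhs_z.simps rhs_w.simps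
        intro!: derivative_eq_intros)
qed (auto simp: birational_generators parameter_space_def algebra_simps split: if_splits)

theorem theorem2p1:
  shows "(\<forall>T \<in> {s0, s1, s2, s3, s4, s5, pi1, pi2, pi3, pi4}. baecklund_transformation T) \<and>
    (\<forall>T \<in> {s0, s1, s2, s3, s4, s5, pi1, pi2, pi3, pi4}. rat_power T 2 \<approx> rat_id) \<and>
    (\<forall>(S, T) \<in> {(s0, s1), (s0, s3), (s0, s4), (s0, s5), (s1, s3), (s1, s4), (s1, s5),
                 (s2, s4), (s2, s5), (s4, s5)}. rat_power (S \<circ>\<^sub>m T) 2 \<approx> rat_id) \<and>
    (\<forall>(S, T) \<in> {(s0, s2), (s1, s2), (s2, s3), (s3, s4), (s3, s5)}.
        rat_power (S \<circ>\<^sub>m T) 3 \<approx> rat_id)"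
proof (intro conjI ballI)
  fix T assume "T \<in> {s0, s1, s2, s3, s4, s5, pi1, pi2, pi3, pi4}"
  then show "baecklund_transformation T"
    using baecklund_s0 baecklund_s1 baecklund_s2 baecklund_s3 baecklund_s4 baecklund_s5
      baecklund_pi1 baecklund_pi2 baecklund_pi3 baecklund_pi4 by blast
next
  fix T assume "T \<in> {s0, s1, s2, s3, s4, s5, pi1, pi2, pi3, pi4}"
  then show "rat_power T 2 \<approx> rat_id"
    using simple_reflections[THEN simple_reflection_square] pi1_square pi2_square pi3_square pi4_square
    by (elim insertE emptyE) (simp_all only:)
qed (simp_all only: split_paired_all prod.case commutation_relations braid_relations)

end
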